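(* For each $k\ge 1$ let $X_1,\dots,X_k$ be independent with $X_i\sim \mathrm{Binomial}(n_i,\pi_i)$, $0<\pi_i<1$, where $n_i=n_i^{(k)}$ and $\pi_i=\pi_i^{(k)}$ may depend on $k$. Put $\theta_i=\pi_i(1-\pi_i)$ and let $\bar\pi$, $\mathcal T_S$, $\mathcal B_k$, $\mathcal B_{0k}$, $T_0$ be as defined in the context. Suppose that, as $k\to\infty$, $$\frac{\sum_{i=1}^k\left(\theta_i^4+\frac{\theta_i}{n_i}\right)}{(\bar\pi(1-\bar\pi))^4\,\mathcal B_k^2}\to 0\qquad\text{and}\qquad \frac{\sum_{i=1}^k n_i^2\theta_i(\pi_i-\bar\pi)^4\left(\theta_i+\frac1{n_i}\right)}{(\bar\pi(1-\bar\pi))^4\,\mathcal B_k^2}\to 0 .$$ Then, for every fixed $\alpha\in(0,1)$, as $k\to\infty$, $$P(T_0>z_{1-\alpha})-\bar\Phi\left(\frac{z_{1-\alpha}}{\sigma_k}-\mu_k\right)\to 0,$$ where $\mu_k=\frac{E(\mathcal T_S)-k}{\sqrt{\mathcal B_k}}$ and $\sigma_k^2=\frac{\mathcal B_k}{\mathcal B_{0k}}$.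
   Context: Triangular array setting: all parameters $n_i,\pi_i$ may vary with $k$; the superscript $k$ is suppressed. $N=\sum_{i=1}^k n_i$ and $\bar\pi=\frac1N\sum_{i=1}^k n_i\pi_i$. Define $$\mathcal T_S=\sum_{i=1}^k\frac{(X_i-n_i\bar\pi)^2}{n_i\bar\pi(1-\bar\pi)},\qquad \mathcal B_k=\mathrm{Var}(\mathcal T_S)=\sum_{i=1}^k\mathrm{Var}\left(\frac{(X_i-n_i\bar\pi)^2}{n_i\bar\pi(1-\bar\pi)}\right),$$ $$\mathcal B_{0k}=\sum_{i=1}^k\left(2-\frac6{n_i}+\frac1{n_i\bar\pi(1-\bar\pi)}\right),\qquad T_0=\frac{\mathcal T_S-k}{\sqrt{\mathcal B_{0k}}}.$$ One has $E(\mathcal T_S)=\sum_{i=1}^k\left(\frac{n_i(\pi_i-\bar\pi)^2}{\bar\pi(1-\bar\pi)}+\frac{\pi_i(1-\pi_i)}{\bar\pi(1-\bar\pi)}\right)$. It is implicit that $\mathcal B_k>0$ and $\mathcal B_{0k}>0$, so that the quantities are defined. $\bar\Phi(z)=1-\Phi(z)=P(Z\ge z)$ for $Z$ standard normal, and $z_{1-\alpha}$ is the $(1-\alpha)$-quantile of the standard normal distribution. *)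

theory Defs
  imports "HOL-Probability.Probability"
begin

text \<open>
  The functions below describe a single row of the triangular array: \<open>n i\<close>, \<open>\<pi> i\<close> and \<open>X i\<close> are used
  for \<open>i\<close> in \<open>{1..k}\<close> only, and \<open>M\<close> is the probability space on which the row lives.
\<close>

definition pi_bar :: "nat \<Rightarrow> (nat \<Rightarrow> nat) \<Rightarrow> (nat \<Rightarrow> real) \<Rightarrow> real" where
  "pi_bar k n \<pi> = (\<Sum>i=1..k. real (n i) * \<pi> i) / real (\<Sum>i=1..k. n i)"

definition T_S :: "nat \<Rightarrow> (nat \<Rightarrow> nat) \<Rightarrow> (nat \<Rightarrow> real) \<Rightarrow> (nat \<Rightarrow> 'a \<Rightarrow> nat) \<Rightarrow> 'a \<Rightarrow> real" where
  "T_S k n \<pi> X \<omega> =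
     (\<Sum>i=1..k. (real (X i \<omega>) - real (n i) * pi_bar k n \<pi>)\<^sup>2
                  / (real (n i) * pi_bar k n \<pi> * (1 - pi_bar k n \<pi>)))"

definition mean_T_S ::
    "'a measure \<Rightarrow> nat \<Rightarrow> (nat \<Rightarrow> nat) \<Rightarrow> (nat \<Rightarrow> real) \<Rightarrow> (nat \<Rightarrow> 'a \<Rightarrow> nat) \<Rightarrow> real" where
  "mean_T_S M k n \<pi> X = prob_space.expectation M (T_S k n \<pi> X)"

definition B_var ::
    "'a measure \<Rightarrow> nat \<Rightarrow> (nat \<Rightarrow> nat) \<Rightarrow> (nat \<Rightarrow> real) \<Rightarrow> (nat \<Rightarrow> 'a \<Rightarrow> nat) \<Rightarrow> real" where
  "B_var M k n \<pi> X = prob_space.variance M (T_S k n \<pi> X)"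

definition B_null :: "nat \<Rightarrow> (nat \<Rightarrow> nat) \<Rightarrow> (nat \<Rightarrow> real) \<Rightarrow> real" where
  "B_null k n \<pi> =
     (\<Sum>i=1..k. 2 - 6 / real (n i) + 1 / (real (n i) * pi_bar k n \<pi> * (1 - pi_bar k n \<pi>)))"

definition T_0 :: "nat \<Rightarrow> (nat \<Rightarrow> nat) \<Rightarrow> (nat \<Rightarrow> real) \<Rightarrow> (nat \<Rightarrow> 'a \<Rightarrow> nat) \<Rightarrow> 'a \<Rightarrow> real" where
  "T_0 k n \<pi> X \<omega> = (T_S k n \<pi> X \<omega> - real k) / sqrt (B_null k n \<pi>)"

definition mu_k ::
    "'a measure \<Rightarrow> nat \<Rightarrow> (nat \<Rightarrow> nat) \<Rightarrow> (nat \<Rightarrow> real) \<Rightarrow> (nat \<Rightarrow> 'a \<Rightarrow> nat) \<Rightarrow> real" where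
  "mu_k M k n \<pi> X = (mean_T_S M k n \<pi> X - real k) / sqrt (B_var M k n \<pi> X)"

definition sigma_k ::
    "'a measure \<Rightarrow> nat \<Rightarrow> (nat \<Rightarrow> nat) \<Rightarrow> (nat \<Rightarrow> real) \<Rightarrow> (nat \<Rightarrow> 'a \<Rightarrow> nat) \<Rightarrow> real" where
  "sigma_k M k n \<pi> X = sqrt (B_var M k n \<pi> X / B_null k n \<pi>)"

definition quantile :: "real measure \<Rightarrow> real \<Rightarrow> real" where
  "quantile M p = Inf {x. p \<le> cdf M x}"

definition Phi_bar :: "real \<Rightarrow> real" where
  "Phi_bar z = 1 - cdf std_normal_distribution z"

end

theory Submission
  imports Defs
begin

text \<open>
  Expanding \<open>X\<^sub>i - n\<^sub>i q = D\<^sub>i + n\<^sub>i (\<pi>\<^sub>i - q)\<close> with \<open>D\<^sub>i = X\<^sub>i - n\<^sub>i \<pi>\<^sub>i\<close> and \<open>q\<close> the pooled proportion, each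
  centred summand of the statistic is \<open>((D\<^sub>i\<^sup>2 - n\<^sub>i \<theta>\<^sub>i) / n\<^sub>i + 2 (\<pi>\<^sub>i - q) D\<^sub>i) / (q (1 - q))\<close>.
  The bounds \<open>E D\<^sub>i\<^sup>4 \<le> 3 a\<^sup>2 + a\<close> and \<open>E D\<^sub>i\<^sup>8 \<le> C (a\<^sup>4 + a)\<close> for \<open>a = n\<^sub>i \<theta>\<^sub>i\<close> therefore turn the two
  hypotheses into Lyapunov's condition with fourth moments, and the standardised statistic is
  asymptotically normal. The evaluation point of its distribution function varies with \<open>k\<close>
  without any control, so convergence in distribution is upgraded to uniform convergence of
  distribution functions by Polya's theorem.
\<close>

section \<open>Uniform convergence of distribution functions\<close>

text \<open>Continuity gives points \<open>q j\<close> at which \<open>G\<close> takes the values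
  j/m for 0 < j < m. Pointwise convergence is simultaneous at these finitely many points, and
  monotonicity carries it to every x. The error is 1/m from the spacing of the levels and 1/m from
  the convergence, hence the choice 2/m < e.\<close>

lemma polya_uniform_convergence:
  fixes F :: "nat \<Rightarrow> real \<Rightarrow> real" and G :: "real \<Rightarrow> real"
  assumes F_mono: "\<And>n. mono (F n)" and F_range: "\<And>n x. F n x \<in> {0..1}"
    and G_mono: "mono G" and G_cont: "continuous_on UNIV G"
    and G_bot: "(G \<longlongrightarrow> 0) at_bot" and G_top: "(G \<longlongrightarrow> 1) at_top"
    and conv: "\<And>x. (\<lambda>n. F n x) \<longlonglongrightarrow> G x"
  shows "uniform_limit UNIV F G sequentially"
proof (rule uniform_limitI)
  fix e :: real assume "e > 0"
  then obtain m0 :: nat where m0: "2 / e < real m0"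
    using reals_Archimedean2 by blast
  define m where "m = Suc m0"
  have m: "m > 0" "2 / real m < e"
    using m0 \<open>e > 0\<close> by (auto simp: m_def field_simps)
  have ex: "\<exists>x. G x = real j / real m" if "j \<in> {1..<m}" for j
  proof -
    have y: "0 < real j / real m" "real j / real m < 1"
      using that by auto
    obtain a where a: "\<And>x. x \<le> a \<Longrightarrow> G x < real j / real m"
      using order_tendstoD(2)[OF G_bot y(1)] by (auto simp: eventually_at_bot_linorder)
    obtain b where b: "\<And>x. x \<ge> b \<Longrightarrow> G x > real j / real m"
      using order_tendstoD(1)[OF G_top y(2)] by (auto simp: eventually_at_top_linorder)
    \<comment> \<open>Taking \<open>min a b\<close> and \<open>max a b\<close> as end points spares
      a proof that \<open>a\<close> lies to the left of \<open>b\<close>.\<close>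
    have "\<exists>x\<ge>min a b. x \<le> max a b \<and> G x = real j / real m"
    proof (rule IVT')
      show "continuous_on {min a b..max a b} G"
        using G_cont by (rule continuous_on_subset) simp
    qed (use a[of "min a b"] b[of "max a b"] in simp_all)
    then show ?thesis by blast
  qed
  then obtain q where q: "\<And>j. j \<in> {1..<m} \<Longrightarrow> G (q j) = real j / real m"
    by metis
  have "\<forall>\<^sub>F n in sequentially. \<forall>j\<in>{1..<m}. dist (F n (q j)) (G (q j)) < 1 / real m"
    using m by (intro eventually_ball_finite ballI tendstoD conv) auto
  then show "\<forall>\<^sub>F n in sequentially. \<forall>x\<in>UNIV. dist (F n x) (G x) < e"
  proof eventually_elim
    case (elim n)
    have near: "\<bar>F n (q j) - real j / real m\<bar> < 1 / real m" if "j \<in> {1..<m}" for j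
      using elim that q by (auto simp: dist_real_def)
    show ?case
    proof
      fix x
      have Gx: "0 \<le> G x" "G x \<le> 1"
        using F_range by (auto intro: LIMSEQ_le_const[OF conv] LIMSEQ_le_const2[OF conv])
      have two: "2 / real m = 1 / real m + 1 / real m" by simp
      have upper: "F n x \<le> G x + 2 / real m"
      proof -
        \<comment> \<open>\<open>j\<close> is the least integer strictly above m * G x. Strictness
          is what lets monotonicity of \<open>G\<close> place x to the left of \<open>q j\<close>.
          If j \<ge> m there is no such grid point, but then G x \<ge> 1 - 1/m and F n x \<le> 1 is
          enough.\<close>
        define j where "j = Suc (nat \<lfloor>real m * G x\<rfloor>)"
        have "real m * G x \<ge> 0" using Gx by simp
        then have j: "real m * G x < real j" "real j \<le> real m * G x + 1"
          unfolding j_def by linarith+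
        show ?thesis
        proof (cases "j < m")
          case True
          then have j_in: "j \<in> {1..<m}" by (simp add: j_def)
          have "G x < real j / real m"
            using j m by (simp add: pos_less_divide_eq mult.commute)
          then have "x \<le> q j"
            using q[OF j_in] monoD[OF G_mono, of "q j" x] by linarith
          then have "F n x \<le> F n (q j)" by (rule monoD[OF F_mono])
          moreover have "real j / real m \<le> G x + 1 / real m"
            using j m by (simp add: field_simps)
          ultimately show ?thesis using near[OF j_in] unfolding two by linarith
        next
          case False
          then have "real m \<le> real m * G x + 1" using j by linarith
          then have "1 \<le> G x + 1 / real m" using m by (simp add: field_simps)
          moreover have "F n x \<le> 1" using F_range[of n x] by simp
          moreover have "1 / real m \<ge> 0" by simp
          ultimately show ?thesis unfolding two by linarith
        qed
      qed
      have lower: "G x \<le> F n x + 2 / real m"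
      proof -
        \<comment> \<open>Dually, the greatest integer strictly below m * G x. For m * G x \<le> 1
          it would not index a grid point, and F n x \<ge> 0 is enough.\<close>
        define j where "j = nat (\<lceil>real m * G x\<rceil> - 1)"
        show ?thesis
        proof (cases "real m * G x \<le> 1")
          case True
          then have "G x \<le> 1 / real m" using m by (simp add: field_simps)
          moreover have "F n x \<ge> 0" using F_range[of n x] by simp
          moreover have "1 / real m \<ge> 0" by simp
          ultimately show ?thesis unfolding two by linarith
        next
          case False
          then have j: "real m * G x \<le> real j + 1" "real j < real m * G x" "1 \<le> j"
            unfolding j_def by linarith+
          have "real j < real m * 1"
            using j(2) Gx(2) m by (metis less_le_trans mult_left_mono of_nat_0_le_iff)
          then have j_in: "j \<in> {1..<m}" using j by simp
          have "real j / real m < G x"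
            using j m by (simp add: pos_divide_less_eq mult.commute)
          then have "q j \<le> x"
            using q[OF j_in] monoD[OF G_mono, of x "q j"] by linarith
          then have "F n (q j) \<le> F n x" by (rule monoD[OF F_mono])
          moreover have "G x \<le> real j / real m + 1 / real m"
            using j m by (simp add: field_simps)
          ultimately show ?thesis using near[OF j_in] unfolding two by linarith
        qed
      qed
      show "dist (F n x) (G x) < e"
        using upper lower m by (simp add: dist_real_def abs_less_iff)
    qed
  qed
qed

text \<open>The jump of a distribution function at x is the mass of {x}, and a measure with a
  Lebesgue density gives points no mass.\<close>

lemma continuous_cdf_std_normal: "continuous_on UNIV (cdf std_normal_distribution)"
proof -
  interpret N: real_distribution std_normal_distribution by (rule real_dist_normal_dist)
  have "measure std_normal_distribution {x} = 0" for x
  proof -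
    have "emeasure std_normal_distribution {x} = 0"
      by (subst emeasure_density) (auto intro!: nn_integral_0_iff_AE[THEN iffD2] AE_I[of _ _ "{x}"] simp: indicator_def)
    then show ?thesis by (simp add: measure_def)
  qed
  then show ?thesis
    by (auto simp: continuous_on_eq_continuous_at N.isCont_cdf)
qed

text \<open>Weak convergence yields convergence at continuity points of the limit; for the normal
  law these are all points, so Polya's theorem applies.\<close>

lemma weak_conv_std_normal_uniform:
  assumes \<mu>: "\<And>m. real_distribution (\<mu> m)" and conv: "weak_conv_m \<mu> std_normal_distribution"
  shows "uniform_limit UNIV (\<lambda>m. cdf (\<mu> m)) (cdf std_normal_distribution) sequentially"
proof (rule polya_uniform_convergence)
  interpret N: real_distribution std_normal_distribution by (rule real_dist_normal_dist)
  show "mono (cdf (\<mu> m))" for m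
  proof -
    interpret real_distribution "\<mu> m" by (rule \<mu>)
    show ?thesis by (simp add: mono_def cdf_nondecreasing)
  qed
  show "cdf (\<mu> m) x \<in> {0..1}" for m x
  proof -
    interpret real_distribution "\<mu> m" by (rule \<mu>)
    show ?thesis by (simp add: cdf_nonneg cdf_bounded_prob)
  qed
  show "mono (cdf std_normal_distribution)" by (simp add: mono_def N.cdf_nondecreasing)
  show "(cdf std_normal_distribution \<longlongrightarrow> 0) at_bot" by (rule N.cdf_lim_at_bot)
  show "(cdf std_normal_distribution \<longlongrightarrow> 1) at_top" by (rule N.cdf_lim_at_top_prob)
  show "continuous_on UNIV (cdf std_normal_distribution)" by (rule continuous_cdf_std_normal)
  then show "(\<lambda>m. cdf (\<mu> m) x) \<longlonglongrightarrow> cdf std_normal_distribution x" for x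
    using conv by (simp add: weak_conv_m_def weak_conv_def continuous_on_eq_continuous_at)
qed

section \<open>Lyapunov's central limit theorem for triangular arrays\<close>

text \<open>For the upper bound on exp (- x), multiply the Taylor polynomials of exp (- x) and exp
  x: the product is 1 + x^4/4 \<ge> 1, and the second factor is at most exp x.\<close>

lemma exp_minus_quadratic_bound:
  fixes x :: real
  assumes "x \<ge> 0"
  shows "\<bar>1 - x - exp (- x)\<bar> \<le> x\<^sup>2 / 2"
proof -
  have "1 - x \<le> exp (- x)" using exp_ge_add_one_self[of "- x"] by simp
  moreover have "exp (- x) \<le> 1 - x + x\<^sup>2 / 2"
  proof -
    have "1 \<le> (1 - x + x\<^sup>2 / 2) * (1 + x + x\<^sup>2 / 2)"
    proof -
      have "(1 - x + x\<^sup>2 / 2) * (1 + x + x\<^sup>2 / 2) = 1 + (x\<^sup>2)\<^sup>2 / 4"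
        by (simp add: algebra_simps power2_eq_square)
      then show ?thesis by simp
    qed
    also have "\<dots> \<le> (1 - x + x\<^sup>2 / 2) * exp x"
    proof (intro mult_left_mono)
      show "1 + x + x\<^sup>2 / 2 \<le> exp x" by (rule exp_lower_Taylor_quadratic[OF assms])
      \<comment> \<open>This is twice the factor 1 - x + x^2/2.\<close>
      have "0 \<le> (x - 1)\<^sup>2 + 1" by simp
      then show "0 \<le> 1 - x + x\<^sup>2 / 2" by (simp add: power2_eq_square algebra_simps)
    qed
    finally show ?thesis by (simp add: exp_minus field_simps)
  qed
  ultimately show ?thesis by (simp add: abs_if)
qed

context prob_space
begin

text \<open>The third claim is the nonnegativity of the variance of the squared variable.\<close>

lemma
  fixes X :: "'a \<Rightarrow> real"
  assumes rv: "random_variable borel X" and int4: "integrable M (\<lambda>\<omega>. X \<omega> ^ 4)"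
  shows power4_imp_integrable_square: "integrable M (\<lambda>\<omega>. (X \<omega>)\<^sup>2)"
    and power4_imp_integrable: "integrable M X"
    and square_expectation_square_le: "(expectation (\<lambda>\<omega>. (X \<omega>)\<^sup>2))\<^sup>2 \<le> expectation (\<lambda>\<omega>. X \<omega> ^ 4)"
proof -
  note rv[measurable]
  have eq: "(\<lambda>\<omega>. ((X \<omega>)\<^sup>2)\<^sup>2) = (\<lambda>\<omega>. X \<omega> ^ 4)" by simp
  show int2: "integrable M (\<lambda>\<omega>. (X \<omega>)\<^sup>2)"
    by (rule square_integrable_imp_integrable) (use int4 in \<open>simp_all add: eq\<close>)
  show "integrable M X"
    by (rule square_integrable_imp_integrable[OF rv int2])
  show "(expectation (\<lambda>\<omega>. (X \<omega>)\<^sup>2))\<^sup>2 \<le> expectation (\<lambda>\<omega>. X \<omega> ^ 4)"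
    using variance_eq[OF int2] variance_positive[of "\<lambda>\<omega>. (X \<omega>)\<^sup>2"] int4 by (simp add: eq)
qed

text \<open>The second-order Taylor estimate of a characteristic function involves the third
  absolute moment. The free parameter \<epsilon> trades it for the second and fourth moments, the
  only ones that are controlled later.\<close>

lemma char_gaussian_approx:
  fixes X :: "'a \<Rightarrow> real"
  assumes rv: "random_variable borel X" and int4: "integrable M (\<lambda>\<omega>. X \<omega> ^ 4)"
    and mean: "expectation X = 0" and \<epsilon>: "\<epsilon> > 0"
  shows "cmod (char (distr M borel X) t - exp (- (t\<^sup>2 * expectation (\<lambda>\<omega>. (X \<omega>)\<^sup>2) / 2))) \<le>
    \<bar>t\<bar> ^ 3 / 12 * (\<epsilon> * expectation (\<lambda>\<omega>. (X \<omega>)\<^sup>2) + expectation (\<lambda>\<omega>. X \<omega> ^ 4) / \<epsilon>)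
    + t ^ 4 / 8 * expectation (\<lambda>\<omega>. X \<omega> ^ 4)"
proof -
  note rv[measurable]
  define s where "s = expectation (\<lambda>\<omega>. (X \<omega>)\<^sup>2)"
  define L where "L = expectation (\<lambda>\<omega>. X \<omega> ^ 4)"
  note int2 = power4_imp_integrable_square[OF rv int4] and int1 = power4_imp_integrable[OF rv int4]
  have s: "s \<ge> 0" by (simp add: s_def)
  have "s\<^sup>2 \<le> L" unfolding s_def L_def by (rule square_expectation_square_le[OF rv int4])
  \<comment> \<open>The arithmetic-geometric mean inequality for \<epsilon> x^2 and x^4/\<epsilon>,
    whose geometric mean is |x|^3.\<close>
  have pt: "min (6 * x\<^sup>2) (\<bar>t\<bar> * \<bar>x\<bar> ^ 3) \<le> \<bar>t\<bar> / 2 * (\<epsilon> * x\<^sup>2 + x ^ 4 / \<epsilon>)" for x :: real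
  proof -
    have "0 \<le> x\<^sup>2 * (\<epsilon> - \<bar>x\<bar>)\<^sup>2" by simp
    also have "x\<^sup>2 * (\<epsilon> - \<bar>x\<bar>)\<^sup>2 = \<epsilon> * (\<epsilon> * x\<^sup>2 + x ^ 4 / \<epsilon> - 2 * \<bar>x\<bar> ^ 3)"
      using \<epsilon> by (simp add: power2_eq_square field_simps numeral_eq_Suc abs_if)
    finally have "2 * \<bar>x\<bar> ^ 3 \<le> \<epsilon> * x\<^sup>2 + x ^ 4 / \<epsilon>"
      using \<epsilon> by (simp add: zero_le_mult_iff)
    then have "\<bar>t\<bar> * \<bar>x\<bar> ^ 3 \<le> \<bar>t\<bar> / 2 * (\<epsilon> * x\<^sup>2 + x ^ 4 / \<epsilon>)"
      using mult_left_mono[of "2 * \<bar>x\<bar> ^ 3" _ "\<bar>t\<bar> / 2"] by simp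
    then show ?thesis by linarith
  qed
  have "cmod (char (distr M borel X) t - (1 - t\<^sup>2 * s / 2)) \<le>
      t\<^sup>2 / 6 * expectation (\<lambda>\<omega>. min (6 * (X \<omega>)\<^sup>2) (\<bar>t\<bar> * \<bar>X \<omega>\<bar> ^ 3))"
    by (rule char_approx3') (use int1 int2 mean in \<open>simp_all add: s_def\<close>)
  also have "expectation (\<lambda>\<omega>. min (6 * (X \<omega>)\<^sup>2) (\<bar>t\<bar> * \<bar>X \<omega>\<bar> ^ 3)) \<le>
      expectation (\<lambda>\<omega>. \<bar>t\<bar> / 2 * (\<epsilon> * (X \<omega>)\<^sup>2 + X \<omega> ^ 4 / \<epsilon>))"
  proof (rule integral_mono)
    show "integrable M (\<lambda>\<omega>. min (6 * (X \<omega>)\<^sup>2) (\<bar>t\<bar> * \<bar>X \<omega>\<bar> ^ 3))"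
      by (rule Bochner_Integration.integrable_bound[of _ "\<lambda>\<omega>. 6 * (X \<omega>)\<^sup>2"]) (use int2 in auto)
  qed (use int2 int4 pt in auto)
  also have "\<dots> = \<bar>t\<bar> / 2 * (\<epsilon> * s + L / \<epsilon>)"
    using int2 int4 by (simp add: s_def L_def)
  finally have "cmod (char (distr M borel X) t - (1 - t\<^sup>2 * s / 2)) \<le>
      t\<^sup>2 / 6 * (\<bar>t\<bar> / 2 * (\<epsilon> * s + L / \<epsilon>))"
    by (simp add: mult_left_mono)
  also have "\<dots> = \<bar>t\<bar> ^ 3 / 12 * (\<epsilon> * s + L / \<epsilon>)"
    by (simp add: power3_eq_cube power2_eq_square abs_if)
  finally have 1: "cmod (char (distr M borel X) t - (1 - t\<^sup>2 * s / 2)) \<le> \<bar>t\<bar> ^ 3 / 12 * (\<epsilon> * s + L / \<epsilon>)" .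
  \<comment> \<open>The second error comes from replacing the quadratic polynomial by the Gaussian
    factor; its s^2 is absorbed by the fourth moment.\<close>
  have "cmod (complex_of_real (1 - t\<^sup>2 * s / 2) - complex_of_real (exp (- (t\<^sup>2 * s / 2)))) = \<bar>1 - t\<^sup>2 * s / 2 - exp (- (t\<^sup>2 * s / 2))\<bar>"
    unfolding of_real_diff[symmetric] norm_of_real by simp
  also have "\<dots> \<le> (t\<^sup>2 * s / 2)\<^sup>2 / 2"
    using s by (intro exp_minus_quadratic_bound) simp
  also have "\<dots> = t ^ 4 / 8 * s\<^sup>2"
    by (simp add: power_mult_distrib power_divide)
  also have "\<dots> \<le> t ^ 4 / 8 * L"
    using \<open>s\<^sup>2 \<le> L\<close> by (intro mult_left_mono) auto
  finally have 2: "cmod (complex_of_real (1 - t\<^sup>2 * s / 2) - complex_of_real (exp (- (t\<^sup>2 * s / 2)))) \<le> t ^ 4 / 8 * L" .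
  show ?thesis
    unfolding s_def[symmetric] L_def[symmetric]
    by (rule norm_diff_triangle_le[OF 1 2])
qed

text \<open>The cross terms vanish, since each variable is independent of the sum of the others and
  centred. Integrability is part of the conclusion so that the induction hypothesis makes the
  partial sum square integrable.\<close>

lemma expectation_square_sum_indep:
  fixes X :: "'i \<Rightarrow> 'a \<Rightarrow> real"
  assumes "finite I" "indep_vars (\<lambda>_. borel) X I"
    and "\<And>i. i \<in> I \<Longrightarrow> integrable M (\<lambda>\<omega>. (X i \<omega>)\<^sup>2)"
    and "\<And>i. i \<in> I \<Longrightarrow> expectation (X i) = 0"
  shows "integrable M (\<lambda>\<omega>. (\<Sum>i\<in>I. X i \<omega>)\<^sup>2) \<and>
    expectation (\<lambda>\<omega>. (\<Sum>i\<in>I. X i \<omega>)\<^sup>2) = (\<Sum>i\<in>I. expectation (\<lambda>\<omega>. (X i \<omega>)\<^sup>2))"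
  using assms
proof (induction I rule: finite_induct)
  case (insert j I)
  let ?S = "\<lambda>\<omega>. \<Sum>i\<in>I. X i \<omega>"
  have rv: "random_variable borel (X i)" if "i \<in> insert j I" for i
    using insert.prems(1) that by (auto simp: indep_vars_def2)
  have IH: "integrable M (\<lambda>\<omega>. (?S \<omega>)\<^sup>2)"
      "expectation (\<lambda>\<omega>. (?S \<omega>)\<^sup>2) = (\<Sum>i\<in>I. expectation (\<lambda>\<omega>. (X i \<omega>)\<^sup>2))"
    using insert.IH[OF indep_vars_subset[OF insert.prems(1)]] insert.prems by auto
  have indep: "indep_var borel (X j) borel ?S"
    by (rule indep_vars_sum) (use insert in auto)
  have int_j: "integrable M (X j)"
    by (rule square_integrable_imp_integrable) (use rv insert.prems in auto)
  have int_S: "integrable M ?S"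
    by (rule square_integrable_imp_integrable[OF _ IH(1)]) (use rv in auto)
  have prod: "integrable M (\<lambda>\<omega>. X j \<omega> * ?S \<omega>)" "expectation (\<lambda>\<omega>. X j \<omega> * ?S \<omega>) = 0"
    using indep_var_integrable[OF indep int_j int_S]
      indep_var_lebesgue_integral[OF indep int_j int_S] insert.prems by auto
  have eq: "(\<Sum>i\<in>insert j I. X i \<omega>)\<^sup>2 = (X j \<omega>)\<^sup>2 + (?S \<omega>)\<^sup>2 + 2 * (X j \<omega> * ?S \<omega>)" for \<omega>
    using insert.hyps by (simp add: power2_sum)
  show ?case
    unfolding eq using prod IH insert.prems(2)[of j] insert.hyps by simp
qed simp

text \<open>Both characteristic functions are products of factors in the closed unit disc, so their
  distance is at most the sum of the distances of the factors. Since the variances add up to 1, the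
  choice \<epsilon> = sqrt L balances \<epsilon> and L/\<epsilon>.\<close>

lemma lyapunov_char_bound:
  fixes X :: "'i \<Rightarrow> 'a \<Rightarrow> real"
  assumes I: "finite I" and indep: "indep_vars (\<lambda>_. borel) X I"
    and int4: "\<And>i. i \<in> I \<Longrightarrow> integrable M (\<lambda>\<omega>. X i \<omega> ^ 4)"
    and mean: "\<And>i. i \<in> I \<Longrightarrow> expectation (X i) = 0"
    and var: "(\<Sum>i\<in>I. expectation (\<lambda>\<omega>. (X i \<omega>)\<^sup>2)) = 1"
  defines "L \<equiv> \<Sum>i\<in>I. expectation (\<lambda>\<omega>. X i \<omega> ^ 4)"
  shows "cmod (char (distr M borel (\<lambda>\<omega>. \<Sum>i\<in>I. X i \<omega>)) t - exp (- (t\<^sup>2 / 2))) \<le>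
    \<bar>t\<bar> ^ 3 / 6 * sqrt L + t ^ 4 / 8 * L"
proof -
  define s where "s i = expectation (\<lambda>\<omega>. (X i \<omega>)\<^sup>2)" for i
  define l where "l i = expectation (\<lambda>\<omega>. X i \<omega> ^ 4)" for i
  have rv: "random_variable borel (X i)" if "i \<in> I" for i
    using indep that by (simp add: indep_vars_def2)
  have s0: "s i \<ge> 0" and l0: "l i \<ge> 0" for i
    by (simp_all add: s_def l_def)
  \<comment> \<open>Positivity makes sqrt L an admissible \<epsilon>: if L were 0, all variances
    would vanish, against \<open>var\<close>.\<close>
  have "L \<noteq> 0"
  proof
    assume "L = 0"
    then have "l i = 0" if "i \<in> I" for i
      using that I l0 by (simp add: L_def l_def[symmetric] sum_nonneg_eq_0_iff)
    then have "s i = 0" if "i \<in> I" for i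
      using square_expectation_square_le[OF rv int4, OF that that] that
      by (simp add: s_def l_def)
    then show False using var by (simp add: s_def)
  qed
  moreover have "L \<ge> 0" unfolding L_def l_def[symmetric] by (intro sum_nonneg l0)
  ultimately have L: "L > 0" by simp
  have gauss: "complex_of_real (exp (- (t\<^sup>2 / 2))) = (\<Prod>i\<in>I. complex_of_real (exp (- (t\<^sup>2 * s i / 2))))"
  proof -
    have "(\<Prod>i\<in>I. exp (- (t\<^sup>2 * s i / 2))) = exp (\<Sum>i\<in>I. - (t\<^sup>2 / 2) * s i)"
      using I by (simp add: exp_sum)
    also have "\<dots> = exp (- (t\<^sup>2 / 2))"
      using var unfolding sum_distrib_left[symmetric] s_def by simp
    finally show ?thesis by (metis of_real_prod)
  qed
  have "cmod (char (distr M borel (\<lambda>\<omega>. \<Sum>i\<in>I. X i \<omega>)) t - exp (- (t\<^sup>2 / 2))) \<le>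
      (\<Sum>i\<in>I. cmod (char (distr M borel (X i)) t - complex_of_real (exp (- (t\<^sup>2 * s i / 2)))))"
    unfolding char_distr_sum[OF indep] gauss
  proof (rule norm_prod_diff)
    fix i assume "i \<in> I"
    then interpret D: real_distribution "distr M borel (X i)" using rv by simp
    show "cmod (char (distr M borel (X i)) t) \<le> 1" by (rule D.cmod_char_le_1)
    show "cmod (complex_of_real (exp (- (t\<^sup>2 * s i / 2)))) \<le> 1"
      using s0[of i] by (simp only: norm_of_real) simp
  qed
  also have "\<dots> \<le> (\<Sum>i\<in>I. \<bar>t\<bar> ^ 3 / 12 * (sqrt L * s i + l i / sqrt L) + t ^ 4 / 8 * l i)"
    unfolding s_def l_def using L by (intro sum_mono char_gaussian_approx rv int4 mean) auto
  also have "\<dots> = \<bar>t\<bar> ^ 3 / 12 * (sqrt L * sum s I + sum l I / sqrt L) + t ^ 4 / 8 * sum l I"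
    by (simp add: sum.distrib sum_distrib_left sum_divide_distrib distrib_left)
  also have "\<dots> = \<bar>t\<bar> ^ 3 / 6 * sqrt L + t ^ 4 / 8 * L"
    using var L by (simp add: s_def l_def L_def[symmetric] real_div_sqrt)
  finally show ?thesis .
qed

end

text \<open>For each fixed t the bound of \<open>lyapunov_char_bound\<close> tends to 0 with the sum
  of fourth moments, and Levy's continuity theorem concludes.\<close>

theorem lyapunov_central_limit_theorem:
  fixes M :: "nat \<Rightarrow> 'a measure" and X :: "nat \<Rightarrow> 'i \<Rightarrow> 'a \<Rightarrow> real"
  assumes prob: "\<And>m. prob_space (M m)" and fin: "\<And>m. finite (I m)"
    and indep: "\<And>m. prob_space.indep_vars (M m) (\<lambda>_. borel) (X m) (I m)"
    and int4: "\<And>m i. i \<in> I m \<Longrightarrow> integrable (M m) (\<lambda>\<omega>. X m i \<omega> ^ 4)"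
    and mean: "\<And>m i. i \<in> I m \<Longrightarrow> (\<integral>\<omega>. X m i \<omega> \<partial>M m) = 0"
    and var: "\<And>m. (\<Sum>i\<in>I m. \<integral>\<omega>. (X m i \<omega>)\<^sup>2 \<partial>M m) = 1"
    and lyapunov: "(\<lambda>m. \<Sum>i\<in>I m. \<integral>\<omega>. X m i \<omega> ^ 4 \<partial>M m) \<longlonglongrightarrow> 0"
  shows "weak_conv_m (\<lambda>m. distr (M m) borel (\<lambda>\<omega>. \<Sum>i\<in>I m. X m i \<omega>)) std_normal_distribution"
proof (rule levy_continuity)
  show "real_distribution (distr (M m) borel (\<lambda>\<omega>. \<Sum>i\<in>I m. X m i \<omega>))" for m
  proof -
    interpret prob_space "M m" by (rule prob)
    show ?thesis
      using indep[of m] by (intro real_distribution_distr borel_measurable_sum) (simp add: indep_vars_def2)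
  qed
  show "(\<lambda>m. char (distr (M m) borel (\<lambda>\<omega>. \<Sum>i\<in>I m. X m i \<omega>)) t) \<longlonglongrightarrow>
      char std_normal_distribution t" for t
    unfolding char_std_normal_distribution
  proof (rule LIM_zero_cancel, rule Lim_null_comparison)
    let ?L = "\<lambda>m. \<Sum>i\<in>I m. \<integral>\<omega>. X m i \<omega> ^ 4 \<partial>M m"
    show "\<forall>\<^sub>F m in sequentially.
        cmod (char (distr (M m) borel (\<lambda>\<omega>. \<Sum>i\<in>I m. X m i \<omega>)) t - complex_of_real (exp (- t\<^sup>2 / 2)))
          \<le> \<bar>t\<bar> ^ 3 / 6 * sqrt (?L m) + t ^ 4 / 8 * ?L m"
      using prob_space.lyapunov_char_bound[OF prob fin indep int4 mean var, of _ t]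
      by (intro always_eventually allI) (simp del: of_real_exp)
    show "(\<lambda>m. \<bar>t\<bar> ^ 3 / 6 * sqrt (?L m) + t ^ 4 / 8 * ?L m) \<longlonglongrightarrow> 0"
      by (rule tendsto_eq_intros lyapunov refl | simp)+
  qed
qed (rule real_dist_normal_dist)

section \<open>Central moments of the binomial distribution\<close>

text \<open>Condition on the outcome of one of the trials.\<close>

lemma expectation_binomial_pmf_Suc:
  fixes f :: "nat \<Rightarrow> real"
  assumes p: "p \<in> {0..1}"
  shows "measure_pmf.expectation (binomial_pmf (Suc n) p) f =
    p * measure_pmf.expectation (binomial_pmf n p) (\<lambda>x. f (Suc x)) +
    (1 - p) * measure_pmf.expectation (binomial_pmf n p) f"
proof -
  have "binomial_pmf (Suc n) p =
      bernoulli_pmf p \<bind> (\<lambda>b. map_pmf (\<lambda>k. (if b then 1 else 0) + k) (binomial_pmf n p))"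
    by (simp add: binomial_pmf_Suc[OF p] map_pmf_def)
  also have "measure_pmf.expectation \<dots> f = (\<Sum>b\<in>UNIV. pmf (bernoulli_pmf p) b *\<^sub>R
      measure_pmf.expectation (map_pmf (\<lambda>k. (if b then 1 else 0) + k) (binomial_pmf n p)) f)"
    by (rule pmf_expectation_bind) (use p in \<open>auto intro!: finite_imageI\<close>)
  also have "\<dots> = p * measure_pmf.expectation (binomial_pmf n p) (\<lambda>x. f (Suc x)) +
      (1 - p) * measure_pmf.expectation (binomial_pmf n p) f"
    using p by (simp add: UNIV_bool)
  finally show ?thesis .
qed

definition binomial_moment :: "real \<Rightarrow> nat \<Rightarrow> nat \<Rightarrow> real" where
  "binomial_moment p r n =
    measure_pmf.expectation (binomial_pmf n p) (\<lambda>x. (real x - real n * p) ^ r)"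

text \<open>The central moment of order \<open>j\<close> of one trial, whose deviation from
  \<open>p\<close> is 1 - p with probability \<open>p\<close> and - p otherwise.\<close>

definition bernoulli_moment :: "real \<Rightarrow> nat \<Rightarrow> real" where
  "bernoulli_moment p j = p * (1 - p) ^ j + (1 - p) * (- p) ^ j"

text \<open>The deviation for n + 1 trials is the deviation for n trials plus an independent
  Bernoulli deviation; expand the power by the binomial theorem.\<close>

lemma binomial_moment_Suc:
  assumes p: "p \<in> {0..1}"
  shows "binomial_moment p r (Suc n) =
    (\<Sum>k\<le>r. real (r choose k) * binomial_moment p k n * bernoulli_moment p (r - k))"
proof -
  let ?E = "measure_pmf.expectation (binomial_pmf n p)"
  have shift: "?E (\<lambda>x. (real x - real n * p + b) ^ r) =
      (\<Sum>k\<le>r. real (r choose k) * binomial_moment p k n * b ^ (r - k))" for b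
    unfolding binomial_ring binomial_moment_def using p
    by (subst Bochner_Integration.integral_sum) simp_all
  have "binomial_moment p r (Suc n) =
      p * ?E (\<lambda>x. (real x - real n * p + (1 - p)) ^ r) +
      (1 - p) * ?E (\<lambda>x. (real x - real n * p + (- p)) ^ r)"
    unfolding binomial_moment_def expectation_binomial_pmf_Suc[OF p]
    by (simp add: algebra_simps)
  also have "\<dots> = (\<Sum>k\<le>r. real (r choose k) * binomial_moment p k n * bernoulli_moment p (r - k))"
    unfolding shift bernoulli_moment_def
    by (simp add: sum_distrib_left sum.distrib[symmetric] algebra_simps)
  finally show ?thesis .
qed

lemma binomial_moment_0_right:
  assumes "p \<in> {0..1}"
  shows "binomial_moment p r 0 = (if r = 0 then 1 else 0)"
  using assms by (simp add: binomial_moment_def binomial_pmf_0)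

lemma binomial_moment_0_left [simp]: "binomial_moment p 0 n = 1"
  by (simp add: binomial_moment_def)

lemma bernoulli_moment_0 [simp]: "bernoulli_moment p 0 = 1"
  and bernoulli_moment_1 [simp]: "bernoulli_moment p (Suc 0) = 0"
  and bernoulli_moment_2 [simp]: "bernoulli_moment p (Suc (Suc 0)) = p * (1 - p)"
  by (simp_all add: bernoulli_moment_def power2_eq_square algebra_simps)

text \<open>From order two on, p (1 - p) factors out, and what remains is an average, with weights 1
  - p and p, of numbers in [-1, 1].\<close>

lemma abs_bernoulli_moment_le:
  assumes p: "p \<in> {0..1}"
  shows "\<bar>bernoulli_moment p (Suc (Suc j))\<bar> \<le> p * (1 - p)"
proof -
  have "bernoulli_moment p (Suc (Suc j)) = p * (1 - p) * ((1 - p) * (1 - p) ^ j + p * (- p) ^ j)"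
    by (simp add: bernoulli_moment_def algebra_simps)
  moreover have "\<bar>(1 - p) * (1 - p) ^ j + p * (- p) ^ j\<bar> \<le> 1"
  proof -
    have "\<bar>(1 - p) * (1 - p) ^ j + p * (- p) ^ j\<bar> \<le>
        \<bar>(1 - p) * (1 - p) ^ j\<bar> + \<bar>p * (- p) ^ j\<bar>"
      by (rule abs_triangle_ineq)
    also have "\<dots> \<le> (1 - p) * 1 + p * 1"
      unfolding abs_mult power_abs using p
      by (intro add_mono mult_mono power_le_one) auto
    finally show ?thesis by simp
  qed
  ultimately show ?thesis
    using p mult_left_mono[of _ 1 "p * (1 - p)"] by (simp add: abs_mult)
qed

section \<open>Bounds on binomial central moments up to order eight\<close>

context
  fixes p \<theta> :: real
  assumes p: "p \<in> {0..1}" and \<theta>: "\<theta> = p * (1 - p)"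
begin

lemma theta_nonneg: "0 \<le> \<theta>"
  using p by (simp add: \<theta>)

lemma binomial_moment_1: "binomial_moment p 1 n = 0"
  by (induction n) (simp_all add: binomial_moment_0_right[OF p] binomial_moment_Suc[OF p])

lemma binomial_moment_2: "binomial_moment p 2 n = real n * \<theta>"
proof (induction n)
  case (Suc n)
  then show ?case
    using binomial_moment_1[of n]
    by (simp add: binomial_moment_Suc[OF p] numeral_eq_Suc \<theta> algebra_simps)
qed (simp add: binomial_moment_0_right[OF p])

lemma abs_binomial_moment_3_le: "\<bar>binomial_moment p 3 n\<bar> \<le> real n * \<theta>"
proof (induction n)
  case (Suc n)
  have "binomial_moment p 3 (Suc n) = binomial_moment p 3 n + bernoulli_moment p 3"
    using binomial_moment_1[of n]
    by (simp add: binomial_moment_Suc[OF p] numeral_eq_Suc)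
  with Suc abs_bernoulli_moment_le[OF p, of 1] show ?case
    by (simp add: \<theta> algebra_simps numeral_eq_Suc)
qed (simp add: binomial_moment_0_right[OF p])

text \<open>In this and the following recursions the terms containing a first central moment vanish.
  For order eight this removes the moment of order seven.\<close>

lemma binomial_moment_4_Suc:
  "binomial_moment p 4 (Suc n) =
    binomial_moment p 4 n + 6 * binomial_moment p 2 n * \<theta> + bernoulli_moment p 4"
  using binomial_moment_1[of n]
  by (simp add: binomial_moment_Suc[OF p] numeral_eq_Suc \<theta>)

lemma binomial_moment_5_Suc:
  "binomial_moment p 5 (Suc n) =
    binomial_moment p 5 n + 10 * binomial_moment p 3 n * \<theta>
     + 10 * binomial_moment p 2 n * bernoulli_moment p 3 + bernoulli_moment p 5"
  using binomial_moment_1[of n]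
  by (simp add: binomial_moment_Suc[OF p] numeral_eq_Suc \<theta>)

lemma binomial_moment_6_Suc:
  "binomial_moment p 6 (Suc n) =
    binomial_moment p 6 n + 15 * binomial_moment p 4 n * \<theta>
     + 20 * binomial_moment p 3 n * bernoulli_moment p 3
     + 15 * binomial_moment p 2 n * bernoulli_moment p 4 + bernoulli_moment p 6"
  using binomial_moment_1[of n]
  by (simp add: binomial_moment_Suc[OF p] numeral_eq_Suc \<theta>)

lemma binomial_moment_8_Suc:
  "binomial_moment p 8 (Suc n) =
    binomial_moment p 8 n + 28 * binomial_moment p 6 n * \<theta>
     + 56 * binomial_moment p 5 n * bernoulli_moment p 3
     + 70 * binomial_moment p 4 n * bernoulli_moment p 4
     + 56 * binomial_moment p 3 n * bernoulli_moment p 5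
     + 28 * binomial_moment p 2 n * bernoulli_moment p 6 + bernoulli_moment p 8"
  using binomial_moment_1[of n]
  by (simp add: binomial_moment_Suc[OF p] numeral_eq_Suc \<theta>)

text \<open>With a = n \<theta>, one more trial adds at most 6 a \<theta> + \<theta>, while the
  bound grows by this amount plus 3 \<theta>^2. The coefficients of the bounds for orders 5, 6 and 8
  arise in the same way, by integrating the increment in a.\<close>

lemma binomial_moment_4_le: "binomial_moment p 4 n \<le> 3 * (real n * \<theta>)\<^sup>2 + real n * \<theta>"
proof (induction n)
  case (Suc n)
  define a where "a = real n * \<theta>"
  have a: "real (Suc n) * \<theta> = a + \<theta>" by (simp add: a_def algebra_simps)
  have "bernoulli_moment p 4 \<le> \<theta>"
    using abs_bernoulli_moment_le[OF p, of 2] by (simp add: \<theta> numeral_eq_Suc)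
  then have "binomial_moment p 4 (Suc n) \<le> 3 * a\<^sup>2 + a + 6 * (a * \<theta>) + \<theta>"
    using Suc.IH unfolding binomial_moment_4_Suc binomial_moment_2 a_def[symmetric] mult.assoc
    by linarith
  also have "\<dots> = 3 * (a + \<theta>)\<^sup>2 + (a + \<theta>) - 3 * \<theta>\<^sup>2"
    by (simp add: power2_eq_square algebra_simps)
  also have "\<dots> \<le> 3 * (a + \<theta>)\<^sup>2 + (a + \<theta>)" by simp
  finally show ?case unfolding a .
qed (simp add: binomial_moment_0_right[OF p])

lemma abs_binomial_moment_5_le:
  "\<bar>binomial_moment p 5 n\<bar> \<le> 10 * (real n * \<theta>)\<^sup>2 + real n * \<theta>"
proof (induction n)
  case (Suc n)
  define a where "a = real n * \<theta>"
  have a: "real (Suc n) * \<theta> = a + \<theta>" by (simp add: a_def algebra_simps)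
  have a0: "a \<ge> 0" using theta_nonneg by (simp add: a_def)
  have "\<bar>binomial_moment p 3 n * \<theta>\<bar> \<le> a * \<theta>"
    using abs_binomial_moment_3_le[of n] theta_nonneg unfolding abs_mult a_def[symmetric]
    by (intro mult_mono) auto
  moreover have "\<bar>a * bernoulli_moment p 3\<bar> \<le> a * \<theta>"
    using abs_bernoulli_moment_le[OF p, of 1] a0 theta_nonneg unfolding abs_mult
    by (intro mult_mono) (auto simp: \<theta> numeral_eq_Suc)
  moreover have "\<bar>bernoulli_moment p 5\<bar> \<le> \<theta>"
    using abs_bernoulli_moment_le[OF p, of 3] by (simp add: \<theta> numeral_eq_Suc)
  ultimately have "\<bar>binomial_moment p 5 (Suc n)\<bar> \<le>
      10 * a\<^sup>2 + a + 10 * (a * \<theta>) + 10 * (a * \<theta>) + \<theta>"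
    using Suc.IH unfolding binomial_moment_5_Suc binomial_moment_2 a_def[symmetric] mult.assoc
    by linarith
  also have "\<dots> = 10 * (a + \<theta>)\<^sup>2 + (a + \<theta>) - 10 * \<theta>\<^sup>2"
    by (simp add: power2_eq_square algebra_simps)
  also have "\<dots> \<le> 10 * (a + \<theta>)\<^sup>2 + (a + \<theta>)" by simp
  finally show ?case unfolding a .
qed (simp add: binomial_moment_0_right[OF p])

lemma binomial_moment_6_le:
  "binomial_moment p 6 n \<le> 15 * (real n * \<theta>) ^ 3 + 25 * (real n * \<theta>)\<^sup>2 + real n * \<theta>"
proof (induction n)
  case (Suc n)
  define a where "a = real n * \<theta>"
  have a: "real (Suc n) * \<theta> = a + \<theta>" by (simp add: a_def algebra_simps)
  have a0: "a \<ge> 0" using theta_nonneg by (simp add: a_def)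
  have "binomial_moment p 4 n * \<theta> \<le> (3 * a\<^sup>2 + a) * \<theta>"
    using binomial_moment_4_le[of n] theta_nonneg unfolding a_def by (intro mult_right_mono)
  moreover have "\<bar>binomial_moment p 3 n * bernoulli_moment p 3\<bar> \<le> a * \<theta>"
    using abs_binomial_moment_3_le[of n] abs_bernoulli_moment_le[OF p, of 1] a0 theta_nonneg
    unfolding abs_mult a_def[symmetric] by (intro mult_mono) (auto simp: \<theta> numeral_eq_Suc)
  moreover have "\<bar>a * bernoulli_moment p 4\<bar> \<le> a * \<theta>"
    using abs_bernoulli_moment_le[OF p, of 2] a0 theta_nonneg unfolding abs_mult
    by (intro mult_mono) (auto simp: \<theta> numeral_eq_Suc)
  moreover have "\<bar>bernoulli_moment p 6\<bar> \<le> \<theta>"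
    using abs_bernoulli_moment_le[OF p, of 4] by (simp add: \<theta> numeral_eq_Suc)
  ultimately have "binomial_moment p 6 (Suc n) \<le> 15 * a ^ 3 + 25 * a\<^sup>2 + a
      + 15 * ((3 * a\<^sup>2 + a) * \<theta>) + 20 * (a * \<theta>) + 15 * (a * \<theta>) + \<theta>"
    using Suc.IH unfolding binomial_moment_6_Suc binomial_moment_2 a_def[symmetric] mult.assoc
      abs_le_iff by linarith
  also have "\<dots> = 15 * (a + \<theta>) ^ 3 + 25 * (a + \<theta>)\<^sup>2 + (a + \<theta>)
      - (15 * (3 * a * \<theta>\<^sup>2 + \<theta> ^ 3) + 25 * \<theta>\<^sup>2)"
    by (simp add: power2_eq_square power3_eq_cube algebra_simps)
  also have "\<dots> \<le> 15 * (a + \<theta>) ^ 3 + 25 * (a + \<theta>)\<^sup>2 + (a + \<theta>)"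
  proof -
    have "0 \<le> 15 * (3 * a * \<theta>\<^sup>2 + \<theta> ^ 3) + 25 * \<theta>\<^sup>2"
      using a0 theta_nonneg by simp
    then show ?thesis by linarith
  qed
  finally show ?case unfolding a .
qed (simp add: binomial_moment_0_right[OF p])

lemma binomial_moment_8_le:
  "binomial_moment p 8 n \<le> 105 * (real n * \<theta>) ^ 4 + 490 * (real n * \<theta>) ^ 3
    + 119 * (real n * \<theta>)\<^sup>2 + real n * \<theta>"
proof (induction n)
  case (Suc n)
  define a where "a = real n * \<theta>"
  have a: "real (Suc n) * \<theta> = a + \<theta>" by (simp add: a_def algebra_simps)
  have a0: "a \<ge> 0" using theta_nonneg by (simp add: a_def)
  have "binomial_moment p 6 n * \<theta> \<le> (15 * a ^ 3 + 25 * a\<^sup>2 + a) * \<theta>"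
    using binomial_moment_6_le[of n] theta_nonneg unfolding a_def by (intro mult_right_mono)
  moreover have "\<bar>binomial_moment p 5 n * bernoulli_moment p 3\<bar> \<le> (10 * a\<^sup>2 + a) * \<theta>"
    using abs_binomial_moment_5_le[of n] abs_bernoulli_moment_le[OF p, of 1] a0 theta_nonneg
    unfolding abs_mult a_def[symmetric] by (intro mult_mono) (auto simp: \<theta> numeral_eq_Suc)
  moreover have "\<bar>binomial_moment p 4 n * bernoulli_moment p 4\<bar> \<le> (3 * a\<^sup>2 + a) * \<theta>"
  proof -
    have "0 \<le> binomial_moment p 4 n" by (simp add: binomial_moment_def)
    then show ?thesis
      using binomial_moment_4_le[of n] abs_bernoulli_moment_le[OF p, of 2] a0 theta_nonneg
      unfolding abs_mult a_def[symmetric] by (intro mult_mono) (auto simp: \<theta> numeral_eq_Suc)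
  qed
  moreover have "\<bar>binomial_moment p 3 n * bernoulli_moment p 5\<bar> \<le> a * \<theta>"
    using abs_binomial_moment_3_le[of n] abs_bernoulli_moment_le[OF p, of 3] a0 theta_nonneg
    unfolding abs_mult a_def[symmetric] by (intro mult_mono) (auto simp: \<theta> numeral_eq_Suc)
  moreover have "\<bar>a * bernoulli_moment p 6\<bar> \<le> a * \<theta>"
    using abs_bernoulli_moment_le[OF p, of 4] a0 theta_nonneg unfolding abs_mult
    by (intro mult_mono) (auto simp: \<theta> numeral_eq_Suc)
  moreover have "\<bar>bernoulli_moment p 8\<bar> \<le> \<theta>"
    using abs_bernoulli_moment_le[OF p, of 6] by (simp add: \<theta> numeral_eq_Suc)
  ultimately have "binomial_moment p 8 (Suc n) \<le> 105 * a ^ 4 + 490 * a ^ 3 + 119 * a\<^sup>2 + a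
      + 28 * ((15 * a ^ 3 + 25 * a\<^sup>2 + a) * \<theta>) + 56 * ((10 * a\<^sup>2 + a) * \<theta>)
      + 70 * ((3 * a\<^sup>2 + a) * \<theta>) + 56 * (a * \<theta>) + 28 * (a * \<theta>) + \<theta>"
    using Suc.IH unfolding binomial_moment_8_Suc binomial_moment_2 a_def[symmetric] abs_le_iff
      mult.assoc by linarith
  also have "\<dots> = 105 * a ^ 4 + 490 * a ^ 3 + 119 * a\<^sup>2 + a
      + \<theta> * (420 * a ^ 3 + 1470 * a\<^sup>2 + 238 * a + 1)"
    by (simp add: algebra_simps)
  also have "\<dots> \<le> 105 * (a + \<theta>) ^ 4 + 490 * (a + \<theta>) ^ 3 + 119 * (a + \<theta>)\<^sup>2 + (a + \<theta>)"
  proof -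
    have "105 * (a + \<theta>) ^ 4 + 490 * (a + \<theta>) ^ 3 + 119 * (a + \<theta>)\<^sup>2 + (a + \<theta>) =
        105 * a ^ 4 + 490 * a ^ 3 + 119 * a\<^sup>2 + a
        + \<theta> * (420 * a ^ 3 + 1470 * a\<^sup>2 + 238 * a + 1)
        + (105 * (6 * a\<^sup>2 * \<theta>\<^sup>2 + 4 * a * \<theta> ^ 3 + \<theta> ^ 4) + 490 * (3 * a * \<theta>\<^sup>2 + \<theta> ^ 3) + 119 * \<theta>\<^sup>2)"
      by (simp add: power2_eq_square power3_eq_cube power4_eq_xxxx algebra_simps)
    then show ?thesis using a0 theta_nonneg by simp
  qed
  finally show ?case unfolding a .
qed (simp add: binomial_moment_0_right[OF p])

end

text \<open>The intermediate powers a^2 and a^3 are at most a when a \<le> 1 and at most a^4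
  otherwise; 714 = 105 + 490 + 119.\<close>

lemma binomial_moment_8_crude:
  fixes p :: real and n :: nat
  assumes p: "p \<in> {0..1}"
  defines "a \<equiv> real n * (p * (1 - p))"
  shows "binomial_moment p 8 n \<le> 714 * (a ^ 4 + a)"
proof -
  have a0: "a \<ge> 0" using p by (simp add: a_def)
  have "a ^ 3 \<le> a ^ 4 + a \<and> a\<^sup>2 \<le> a ^ 4 + a"
  proof (cases "a \<le> 1")
    case True
    then have "a ^ 3 \<le> a ^ 1" "a\<^sup>2 \<le> a ^ 1"
      using a0 by (intro power_decreasing; simp)+
    moreover have "0 \<le> a ^ 4" using a0 by (rule zero_le_power)
    ultimately show ?thesis unfolding power_one_right by linarith
  next
    case False
    then have "a ^ 3 \<le> a ^ 4" "a\<^sup>2 \<le> a ^ 4"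
      by (intro power_increasing; simp)+
    then show ?thesis using a0 by simp
  qed
  then show ?thesis
    using binomial_moment_8_le[OF p refl, of n] a0 unfolding a_def[symmetric] by simp
qed

section \<open>Fourth central moment of one summand of the statistic\<close>

lemma power4_sum_le:
  fixes u v :: real
  shows "(u + v) ^ 4 \<le> 8 * (u ^ 4 + v ^ 4)"
proof -
  have sq: "(x + y)\<^sup>2 \<le> 2 * (x\<^sup>2 + y\<^sup>2)" for x y :: real
    using zero_le_power2[of "x - y"] by (simp add: power2_eq_square algebra_simps)
  have "(u + v) ^ 4 = ((u + v)\<^sup>2)\<^sup>2" by simp
  also have "\<dots> \<le> (2 * (u\<^sup>2 + v\<^sup>2))\<^sup>2"
    by (intro power_mono sq) simp
  also have "\<dots> = 4 * (u\<^sup>2 + v\<^sup>2)\<^sup>2"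
    unfolding power_mult_distrib by simp
  also have "\<dots> \<le> 4 * (2 * ((u\<^sup>2)\<^sup>2 + (v\<^sup>2)\<^sup>2))"
    by (intro mult_left_mono sq) simp
  finally show ?thesis by simp
qed

text \<open>The right-hand side is shaped after the summands of the two limit hypotheses of
  \<open>theorem1\<close>. The constant is 45760 = 64 * (714 + 1). If q (1 - q) = 0, division by
  zero makes both sides 0.\<close>

lemma binomial_chi_square_fourth_moment_le:
  fixes p q :: real and n :: nat
  assumes p: "p \<in> {0..1}" and n: "n \<ge> 1"
  defines "\<theta> \<equiv> p * (1 - p)"
    and "Y \<equiv> \<lambda>x. (real x - real n * q)\<^sup>2 / (real n * q * (1 - q))"
  shows "measure_pmf.expectation (binomial_pmf n p)
      (\<lambda>x. (Y x - measure_pmf.expectation (binomial_pmf n p) Y) ^ 4) \<le>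
    45760 * ((\<theta> ^ 4 + \<theta> / real n) + (real n)\<^sup>2 * \<theta> * (p - q) ^ 4 * (\<theta> + 1 / real n))
      / (q * (1 - q)) ^ 4"
proof -
  let ?E = "measure_pmf.expectation (binomial_pmf n p)"
  define D where "D x = real x - real n * p" for x
  define \<delta> where "\<delta> = p - q"
  define c where "c = q * (1 - q)"
  define N where "N = real n"
  define a where "a = N * \<theta>"
  note [simp] = integrable_binomial_pmf[OF p]
  have N: "N \<ge> 1" using n by (simp add: N_def)
  have th: "\<theta> \<ge> 0" using p by (simp add: \<theta>_def)
  have m: "?E (\<lambda>x. D x ^ r) = binomial_moment p r n" for r
    by (simp add: D_def binomial_moment_def)
  have m1: "?E D = 0" using m[of 1] binomial_moment_1[OF p] by simp
  have m2: "?E (\<lambda>x. (D x)\<^sup>2) = a"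
    using m[of 2] binomial_moment_2[OF p refl] by (simp add: a_def \<theta>_def N_def)
  have Y: "Y x = ((D x)\<^sup>2 / N + 2 * \<delta> * D x + N * \<delta>\<^sup>2) / c" for x
  proof -
    have "real x - real n * q = D x + N * \<delta>" by (simp add: D_def \<delta>_def N_def algebra_simps)
    then have "Y x = (D x + N * \<delta>)\<^sup>2 / N / c" by (simp add: Y_def N_def c_def mult.assoc)
    also have "(D x + N * \<delta>)\<^sup>2 / N = (D x)\<^sup>2 / N + 2 * \<delta> * D x + N * \<delta>\<^sup>2"
      using N by (simp add: field_simps power2_eq_square)
    finally show ?thesis .
  qed
  have EY: "?E Y = (\<theta> + N * \<delta>\<^sup>2) / c"
  proof -
    have "?E Y = (?E (\<lambda>x. (D x)\<^sup>2) / N + 2 * \<delta> * ?E D + N * \<delta>\<^sup>2) / c"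
      unfolding Y by simp
    then show ?thesis using N by (simp add: m1 m2 a_def)
  qed
  \<comment> \<open>\<open>power4_sum_le\<close> is used twice: 64 = 8 * 8 for the quadratic part,
    128 = 8 * 2^4 for the linear part. Writing + (- a) gives the difference the form of a
    sum.\<close>
  have pt: "(Y x - ?E Y) ^ 4 \<le> (64 / N ^ 4 * (D x ^ 8 + a ^ 4) + 128 * \<delta> ^ 4 * D x ^ 4) / c ^ 4" for x
  proof -
    have "Y x - ?E Y = (((D x)\<^sup>2 + (- a)) / N + 2 * \<delta> * D x) / c"
      unfolding EY Y diff_divide_distrib[symmetric] using N by (simp add: a_def field_simps)
    then have "(Y x - ?E Y) ^ 4 = (((D x)\<^sup>2 + (- a)) / N + 2 * \<delta> * D x) ^ 4 / c ^ 4"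
      by (simp add: power_divide)
    also have "\<dots> \<le> (8 * ((((D x)\<^sup>2 + (- a)) / N) ^ 4 + (2 * \<delta> * D x) ^ 4)) / c ^ 4"
      by (intro divide_right_mono power4_sum_le) simp
    also have "\<dots> \<le> (8 * (8 * (((D x)\<^sup>2) ^ 4 + (- a) ^ 4) / N ^ 4 + (2 * \<delta> * D x) ^ 4)) / c ^ 4"
      unfolding power_divide
      by (intro divide_right_mono mult_left_mono add_right_mono power4_sum_le) auto
    also have "\<dots> = (64 / N ^ 4 * (D x ^ 8 + a ^ 4) + 128 * \<delta> ^ 4 * D x ^ 4) / c ^ 4"
      by (simp add: power_mult_distrib power_mult[symmetric] algebra_simps)
    finally show ?thesis .
  qed
  have "?E (\<lambda>x. (Y x - ?E Y) ^ 4) \<le>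
      ?E (\<lambda>x. (64 / N ^ 4 * (D x ^ 8 + a ^ 4) + 128 * \<delta> ^ 4 * D x ^ 4) / c ^ 4)"
    by (intro integral_mono pt) simp_all
  also have "\<dots> = (64 / N ^ 4 * (binomial_moment p 8 n + a ^ 4) + 128 * \<delta> ^ 4 * binomial_moment p 4 n) / c ^ 4"
    by (simp add: m)
  also have "\<dots> \<le> (64 / N ^ 4 * (714 * (a ^ 4 + a) + a ^ 4) + 128 * \<delta> ^ 4 * (3 * a\<^sup>2 + a)) / c ^ 4"
    using binomial_moment_8_crude[OF p, of n] binomial_moment_4_le[OF p refl, of n] N
    by (intro divide_right_mono add_mono mult_left_mono) (auto simp: a_def N_def \<theta>_def)
  also have "\<dots> \<le> 45760 * ((\<theta> ^ 4 + \<theta> / N) + N\<^sup>2 * \<theta> * \<delta> ^ 4 * (\<theta> + 1 / N)) / c ^ 4"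
  proof (intro divide_right_mono)
    have "a ^ 4 / N ^ 4 = \<theta> ^ 4" using N by (simp add: a_def power_mult_distrib)
    \<comment> \<open>Here N \<ge> 1 enters: the exact value is \<theta> / N^3.\<close>
    moreover have "a / N ^ 4 \<le> \<theta> / N"
    proof -
      have "a / N ^ 4 = \<theta> / N ^ 3" using N by (simp add: a_def numeral_eq_Suc)
      also have "\<dots> \<le> \<theta> / N ^ 1"
        using N th by (intro divide_left_mono power_increasing) auto
      finally show ?thesis by simp
    qed
    moreover have "64 / N ^ 4 * (714 * (a ^ 4 + a) + a ^ 4) = 45760 * (a ^ 4 / N ^ 4) + 45696 * (a / N ^ 4)"
      by (simp add: add_divide_distrib distrib_left)
    moreover have "0 \<le> a / N ^ 4" using th N by (simp add: a_def)
    ultimately have 1: "64 / N ^ 4 * (714 * (a ^ 4 + a) + a ^ 4) \<le> 45760 * (\<theta> ^ 4 + \<theta> / N)"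
      unfolding distrib_left by linarith
    have e: "N\<^sup>2 * \<theta> * \<delta> ^ 4 * (\<theta> + 1 / N) = \<delta> ^ 4 * (a\<^sup>2 + a)"
      using N by (simp add: a_def field_simps power2_eq_square)
    have "128 * \<delta> ^ 4 * (3 * a\<^sup>2 + a) \<le> 45760 * (\<delta> ^ 4 * (a\<^sup>2 + a))"
    proof -
      have "0 \<le> \<delta> ^ 4 * a\<^sup>2" "0 \<le> \<delta> ^ 4 * a" using th N by (simp_all add: a_def)
      then show ?thesis by (simp add: algebra_simps)
    qed
    with 1 show "64 / N ^ 4 * (714 * (a ^ 4 + a) + a ^ 4) + 128 * \<delta> ^ 4 * (3 * a\<^sup>2 + a) \<le>
        45760 * ((\<theta> ^ 4 + \<theta> / N) + N\<^sup>2 * \<theta> * \<delta> ^ 4 * (\<theta> + 1 / N))"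
      unfolding e distrib_left[of 45760] by (rule add_mono)
  qed simp
  finally show ?thesis by (simp add: N_def \<delta>_def c_def)
qed

section \<open>Asymptotic power of the chi-square test\<close>

theorem theorem1:
  fixes M :: "nat \<Rightarrow> 'a measure"
    and X :: "nat \<Rightarrow> nat \<Rightarrow> 'a \<Rightarrow> nat"
    and n :: "nat \<Rightarrow> nat \<Rightarrow> nat"
    and \<pi> \<theta> :: "nat \<Rightarrow> nat \<Rightarrow> real"
    and \<alpha> :: real
  assumes prob: "\<And>k. k \<ge> 1 \<Longrightarrow> prob_space (M k)"
    and n_pos: "\<And>k i. k \<ge> 1 \<Longrightarrow> i \<in> {1..k} \<Longrightarrow> n k i \<ge> 1"
    and \<pi>_range: "\<And>k i. k \<ge> 1 \<Longrightarrow> i \<in> {1..k} \<Longrightarrow> 0 < \<pi> k i \<and> \<pi> k i < 1"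
    and indep: "\<And>k. k \<ge> 1 \<Longrightarrow>
      prob_space.indep_vars (M k) (\<lambda>_. count_space UNIV) (X k) {1..k}"
    and binomial: "\<And>k i. k \<ge> 1 \<Longrightarrow> i \<in> {1..k} \<Longrightarrow>
      distr (M k) (count_space UNIV) (X k i) = measure_pmf (binomial_pmf (n k i) (\<pi> k i))"
    and \<theta>_def: "\<And>k i. \<theta> k i = \<pi> k i * (1 - \<pi> k i)"
    and B_var_pos: "\<And>k. k \<ge> 1 \<Longrightarrow> B_var (M k) k (n k) (\<pi> k) (X k) > 0"
    and B_null_pos: "\<And>k. k \<ge> 1 \<Longrightarrow> B_null k (n k) (\<pi> k) > 0"
    and cond1: "(\<lambda>k. (\<Sum>i=1..k. \<theta> k i ^ 4 + \<theta> k i / real (n k i))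
        / ((pi_bar k (n k) (\<pi> k) * (1 - pi_bar k (n k) (\<pi> k))) ^ 4
             * (B_var (M k) k (n k) (\<pi> k) (X k))\<^sup>2)) \<longlonglongrightarrow> 0"
    and cond2: "(\<lambda>k. (\<Sum>i=1..k. (real (n k i))\<^sup>2 * \<theta> k i * (\<pi> k i - pi_bar k (n k) (\<pi> k)) ^ 4
                              * (\<theta> k i + 1 / real (n k i)))
        / ((pi_bar k (n k) (\<pi> k) * (1 - pi_bar k (n k) (\<pi> k))) ^ 4
             * (B_var (M k) k (n k) (\<pi> k) (X k))\<^sup>2)) \<longlonglongrightarrow> 0"
    and \<alpha>_range: "0 < \<alpha>" "\<alpha> < 1"
  shows "(\<lambda>k. \<P>(\<omega> in M k. T_0 k (n k) (\<pi> k) (X k) \<omega> > quantile std_normal_distribution (1 - \<alpha>))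
            - Phi_bar (quantile std_normal_distribution (1 - \<alpha>) / sigma_k (M k) k (n k) (\<pi> k) (X k)
                        - mu_k (M k) k (n k) (\<pi> k) (X k))) \<longlonglongrightarrow> 0"
proof -
  define z where "z = quantile std_normal_distribution (1 - \<alpha>)"
  define q where "q k = pi_bar k (n k) (\<pi> k)" for k
  define B where "B k = B_var (M k) k (n k) (\<pi> k) (X k)" for k
  define Y where "Y k i x = (real x - real (n k i) * q k)\<^sup>2 / (real (n k i) * q k * (1 - q k))"
    for k i and x :: nat
  define e where "e k i = (\<integral>\<omega>. Y k i (X k i \<omega>) \<partial>M k)" for k i
  \<comment> \<open>Row \<open>0\<close> is unconstrained, so \<open>W m\<close> and \<open>S m\<close> belong to row \<open>Suc m\<close>.\<close>
  define W where "W m i \<omega> = (Y (Suc m) i (X (Suc m) i \<omega>) - e (Suc m) i) / sqrt (B (Suc m))" for m i \<omega>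
  define S where "S m \<omega> = (\<Sum>i=1..Suc m. W m i \<omega>)" for m \<omega>
  define x where "x k = z / sigma_k (M k) k (n k) (\<pi> k) (X k) - mu_k (M k) k (n k) (\<pi> k) (X k)" for k
  \<comment> \<open>The sum of the two ratios that tend to 0 by hypothesis; a multiple of it will
    dominate the Lyapunov sum.\<close>
  define R where "R k =
      (\<Sum>i=1..k. \<theta> k i ^ 4 + \<theta> k i / real (n k i)) / ((q k * (1 - q k)) ^ 4 * (B k)\<^sup>2)
      + (\<Sum>i=1..k. (real (n k i))\<^sup>2 * \<theta> k i * (\<pi> k i - q k) ^ 4 * (\<theta> k i + 1 / real (n k i)))
        / ((q k * (1 - q k)) ^ 4 * (B k)\<^sup>2)" for k
  have B: "B (Suc m) > 0" for m using B_var_pos[of "Suc m"] by (simp add: B_def)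
  have T_S_eq: "T_S k (n k) (\<pi> k) (X k) \<omega> = (\<Sum>i=1..k. Y k i (X k i \<omega>))" for k \<omega>
    by (simp add: T_S_def Y_def q_def)
  have X_rv: "X k i \<in> measurable (M k) (count_space UNIV)" if "k \<ge> 1" "i \<in> {1..k}" for k i
    using indep[OF that(1)] that unfolding prob_space.indep_vars_def2[OF prob[OF that(1)]] by blast
  \<comment> \<open>A binomial law has finite support, so every function of \<open>X k i\<close> is
    integrable.\<close>
  have int: "integrable (M k) (\<lambda>\<omega>. f (X k i \<omega>))" if "k \<ge> 1" "i \<in> {1..k}" for k i and f :: "nat \<Rightarrow> real"
  proof -
    have "integrable (distr (M k) (count_space UNIV) (X k i)) f"
      unfolding binomial[OF that] using \<pi>_range[OF that] by (intro integrable_binomial_pmf) auto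
    then show ?thesis by (subst (asm) integrable_distr_eq[OF X_rv[OF that]]) auto
  qed
  have lint: "(\<integral>\<omega>. f (X k i \<omega>) \<partial>M k) = measure_pmf.expectation (binomial_pmf (n k i) (\<pi> k i)) f"
    if "k \<ge> 1" "i \<in> {1..k}" for k i and f :: "nat \<Rightarrow> real"
    unfolding binomial[OF that, symmetric] by (subst integral_distr[OF X_rv[OF that]]) auto
  have prob_Suc: "prob_space (M (Suc m))" for m by (rule prob) simp
  have mean_T: "mean_T_S (M (Suc m)) (Suc m) (n (Suc m)) (\<pi> (Suc m)) (X (Suc m)) = (\<Sum>i=1..Suc m. e (Suc m) i)" for m
  proof -
    interpret prob_space "M (Suc m)" by (rule prob_Suc)
    show ?thesis
      unfolding mean_T_S_def e_def T_S_eq[abs_def]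
      by (intro Bochner_Integration.integral_sum int) auto
  qed
  have S_eq: "S m \<omega> = (T_S (Suc m) (n (Suc m)) (\<pi> (Suc m)) (X (Suc m)) \<omega> -
      mean_T_S (M (Suc m)) (Suc m) (n (Suc m)) (\<pi> (Suc m)) (X (Suc m))) / sqrt (B (Suc m))" for m \<omega>
    unfolding S_def W_def mean_T T_S_eq sum_divide_distrib[symmetric] sum_subtractf ..

  \<comment> \<open>Hypotheses of the central limit theorem for the standardised summands\<close>
  have indep_W: "prob_space.indep_vars (M (Suc m)) (\<lambda>_. borel) (W m) {1..Suc m}" for m
    unfolding W_def[abs_def]
    by (rule prob_space.indep_vars_compose2[OF prob_Suc indep]) auto
  have mean_W: "(\<integral>\<omega>. W m i \<omega> \<partial>M (Suc m)) = 0" if "i \<in> {1..Suc m}" for m i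
  proof -
    interpret prob_space "M (Suc m)" by (rule prob_Suc)
    show ?thesis
      unfolding W_def using int[of "Suc m" i "Y (Suc m) i"] that by (simp add: e_def prob_space)
  qed
  have int_W: "integrable (M (Suc m)) (\<lambda>\<omega>. W m i \<omega> ^ r)" if "i \<in> {1..Suc m}" for m i r
    using int[of "Suc m" i "\<lambda>x. ((Y (Suc m) i x - e (Suc m) i) / sqrt (B (Suc m))) ^ r"] that
    by (simp add: W_def)
  \<comment> \<open>\<open>B\<close> is the variance of the whole statistic, so the sum is read
    backwards: by independence it is the second moment of \<open>S m\<close>, the standardised
    statistic.\<close>
  have var_W: "(\<Sum>i\<in>{1..Suc m}. \<integral>\<omega>. (W m i \<omega>)\<^sup>2 \<partial>M (Suc m)) = 1" for m
  proof -
    interpret prob_space "M (Suc m)" by (rule prob_Suc)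
    have "(\<Sum>i\<in>{1..Suc m}. \<integral>\<omega>. (W m i \<omega>)\<^sup>2 \<partial>M (Suc m)) = expectation (\<lambda>\<omega>. (S m \<omega>)\<^sup>2)"
      unfolding S_def
      using expectation_square_sum_indep[OF _ indep_W int_W mean_W] by simp
    also have "\<dots> = 1"
      unfolding S_eq power_divide using B[of m]
      by (simp add: mean_T_S_def B_var_def B_def)
    finally show ?thesis .
  qed
  have fourth_W: "(\<Sum>i\<in>{1..Suc m}. \<integral>\<omega>. W m i \<omega> ^ 4 \<partial>M (Suc m)) \<le> 45760 * R (Suc m)" for m
  proof -
    define k where "k = Suc m"
    have "(\<integral>\<omega>. W m i \<omega> ^ 4 \<partial>M k) \<le> 45760 *
        ((\<theta> k i ^ 4 + \<theta> k i / real (n k i)) / ((q k * (1 - q k)) ^ 4 * (B k)\<^sup>2)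
          + ((real (n k i))\<^sup>2 * \<theta> k i * (\<pi> k i - q k) ^ 4 * (\<theta> k i + 1 / real (n k i)))
          / ((q k * (1 - q k)) ^ 4 * (B k)\<^sup>2))" if i: "i \<in> {1..k}" for i
    proof -
      have k: "k \<ge> 1" by (simp add: k_def)
      have "(\<integral>\<omega>. W m i \<omega> ^ 4 \<partial>M k) = (\<integral>\<omega>. (Y k i (X k i \<omega>) - e k i) ^ 4 / (B k)\<^sup>2 \<partial>M k)"
      proof -
        have "sqrt (B k) ^ 4 = ((sqrt (B k))\<^sup>2)\<^sup>2" by simp
        also have "\<dots> = (B k)\<^sup>2" using B[of m] by (simp add: k_def)
        finally show ?thesis by (simp add: W_def power_divide k_def)
      qed
      also have "\<dots> = (\<integral>\<omega>. (Y k i (X k i \<omega>) - e k i) ^ 4 \<partial>M k) / (B k)\<^sup>2"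
        by simp
      also have "\<dots> \<le> 45760 * ((\<theta> k i ^ 4 + \<theta> k i / real (n k i)) +
          (real (n k i))\<^sup>2 * \<theta> k i * (\<pi> k i - q k) ^ 4 * (\<theta> k i + 1 / real (n k i)))
          / (q k * (1 - q k)) ^ 4 / (B k)\<^sup>2"
      proof (rule divide_right_mono)
        have "\<pi> k i \<in> {0..1}" using \<pi>_range[OF k i] by simp
        from binomial_chi_square_fourth_moment_le[OF this n_pos[OF k i], of "q k"]
        show "(\<integral>\<omega>. (Y k i (X k i \<omega>) - e k i) ^ 4 \<partial>M k) \<le>
            45760 * ((\<theta> k i ^ 4 + \<theta> k i / real (n k i)) +
            (real (n k i))\<^sup>2 * \<theta> k i * (\<pi> k i - q k) ^ 4 * (\<theta> k i + 1 / real (n k i)))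
            / (q k * (1 - q k)) ^ 4"
          using lint[OF k i, of "\<lambda>x. (Y k i x - e k i) ^ 4"] lint[OF k i, of "Y k i"]
          by (simp only: Y_def[abs_def] e_def \<theta>_def)
      qed simp
      finally show ?thesis by (simp add: add_divide_distrib distrib_left)
    qed
    then have "(\<Sum>i\<in>{1..k}. \<integral>\<omega>. W m i \<omega> ^ 4 \<partial>M k) \<le> (\<Sum>i\<in>{1..k}. 45760 *
        ((\<theta> k i ^ 4 + \<theta> k i / real (n k i)) / ((q k * (1 - q k)) ^ 4 * (B k)\<^sup>2)
          + ((real (n k i))\<^sup>2 * \<theta> k i * (\<pi> k i - q k) ^ 4 * (\<theta> k i + 1 / real (n k i)))
          / ((q k * (1 - q k)) ^ 4 * (B k)\<^sup>2)))"
      by (rule sum_mono)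
    then show ?thesis
      unfolding k_def[symmetric] R_def sum_divide_distrib sum.distrib[symmetric] sum_distrib_left .
  qed
  have "R \<longlonglongrightarrow> 0"
    using tendsto_add_zero[OF cond1 cond2] unfolding R_def q_def B_def .
  then have R_lim: "(\<lambda>m. 45760 * R (Suc m)) \<longlonglongrightarrow> 0"
    by (intro tendsto_mult_right_zero LIMSEQ_Suc)
  have "(\<lambda>m. \<Sum>i\<in>{1..Suc m}. \<integral>\<omega>. W m i \<omega> ^ 4 \<partial>M (Suc m)) \<longlonglongrightarrow> 0"
  proof (rule tendsto_sandwich[OF _ _ tendsto_const R_lim])
    show "\<forall>\<^sub>F m in sequentially. 0 \<le> (\<Sum>i\<in>{1..Suc m}. \<integral>\<omega>. W m i \<omega> ^ 4 \<partial>M (Suc m))"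
      by (intro always_eventually allI sum_nonneg) simp
  qed (intro always_eventually allI fourth_W)
  then have "weak_conv_m (\<lambda>m. distr (M (Suc m)) borel (S m)) std_normal_distribution"
    unfolding S_def[abs_def]
    by (intro lyapunov_central_limit_theorem prob_Suc indep_W int_W mean_W var_W) auto
  moreover have S_rv: "S m \<in> borel_measurable (M (Suc m))" for m
    using indep_W[of m] unfolding S_def[abs_def] prob_space.indep_vars_def2[OF prob_Suc]
    by (intro borel_measurable_sum) auto
  ultimately have unif: "uniform_limit UNIV (\<lambda>m. cdf (distr (M (Suc m)) borel (S m)))
      (cdf std_normal_distribution) sequentially"
    by (intro weak_conv_std_normal_uniform prob_space.real_distribution_distr prob_Suc)

  \<comment> \<open>From the rejection event to the distribution function of the standardised
    statistic\<close>
  have prob_eq: "\<P>(\<omega> in M (Suc m). T_0 (Suc m) (n (Suc m)) (\<pi> (Suc m)) (X (Suc m)) \<omega> > z) =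
      1 - cdf (distr (M (Suc m)) borel (S m)) (x (Suc m))" for m
  proof -
    interpret prob_space "M (Suc m)" by (rule prob_Suc)
    note S_rv[of m, measurable]
    define k where "k = Suc m"
    define b where "b = B_null k (n k) (\<pi> k)"
    have b: "b > 0" using B_null_pos[of k] by (simp add: b_def k_def)
    have Bk: "B k > 0" using B[of m] by (simp add: k_def)
    \<comment> \<open>Over the common denominator sqrt (B k), the numerator is the threshold for the
      statistic, centred at its mean. The strict event \<open>T_0 > z\<close> thus becomes the
      complement of \<open>S m \<omega> \<le> x k\<close>, exactly the event measured by the
      distribution function.\<close>
    have x_eq: "x k = (z * sqrt b - (mean_T_S (M k) k (n k) (\<pi> k) (X k) - real k)) / sqrt (B k)"
      using b Bk by (simp add: x_def sigma_k_def mu_k_def B_def[symmetric] b_def[symmetric]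
          real_sqrt_divide diff_divide_distrib)
    have "T_0 k (n k) (\<pi> k) (X k) \<omega> > z \<longleftrightarrow> S m \<omega> > x k" for \<omega>
      unfolding T_0_def S_eq x_eq k_def[symmetric] b_def[symmetric]
      using b Bk by (auto simp: divide_less_cancel pos_less_divide_eq)
    then have "\<P>(\<omega> in M k. T_0 k (n k) (\<pi> k) (X k) \<omega> > z) = \<P>(\<omega> in M k. \<not> S m \<omega> \<le> x k)"
      by (simp add: not_le)
    also have "\<dots> = 1 - \<P>(\<omega> in M k. S m \<omega> \<le> x k)"
      unfolding k_def by (rule prob_neg) measurable
    also have "\<P>(\<omega> in M k. S m \<omega> \<le> x k) = cdf (distr (M k) borel (S m)) (x k)"
      unfolding cdf_def k_def by (subst measure_distr) (auto intro!: arg_cong[where f = prob])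
    finally show ?thesis by (simp add: k_def)
  qed
  have "(\<lambda>m. \<P>(\<omega> in M (Suc m). T_0 (Suc m) (n (Suc m)) (\<pi> (Suc m)) (X (Suc m)) \<omega> > z)
      - Phi_bar (x (Suc m))) \<longlonglongrightarrow> 0"
  proof (rule tendstoI)
    fix \<epsilon> :: real assume "\<epsilon> > 0"
    \<comment> \<open>Uniformity permits evaluation at the moving point \<open>x (Suc m)\<close>;
      the two tail probabilities differ by the difference of the distribution functions, up to
      sign.\<close>
    from uniform_limitD[OF unif this]
    show "\<forall>\<^sub>F m in sequentially. dist (\<P>(\<omega> in M (Suc m). T_0 (Suc m) (n (Suc m)) (\<pi> (Suc m)) (X (Suc m)) \<omega> > z)
      - Phi_bar (x (Suc m))) 0 < \<epsilon>"
      by eventually_elim (simp add: prob_eq Phi_bar_def dist_real_def abs_minus_commute)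
  qed
  \<comment> \<open>Undoes the index shift that excluded row 0.\<close>
  from LIMSEQ_imp_Suc[OF this] show ?thesis
    unfolding z_def x_def .
qed

end
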